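(* For each of the eight assignments of truth values to the properties (P1), (P2), (P3) below, there exists an asymptotic basis $A\subseteq\mathbb{N}$ of order 2 which has exactly those of the properties assigned "true" and fails those assigned "false": (P1) $r_A(n)\to\infty$ as $n\to\infty$; (P2) $A=B\cup C$ where $B$ and $C$ are disjoint asymptotic bases of order 2; (P3) $A$ contains a minimal asymptotic basis of order 2.
   Context: A set $A\subseteq\mathbb{N}$ is an asymptotic basis (of order 2) if there exists $n_0$ such that every integer $n>n_0$ can be written as $n=a+a'$ with $a\le a'$, $a,a'\in A$. The representation function $r_A(n)$ is the number of such representations, i.e. the number of pairs $(a,a')\in A^2$ with $a\le a'$ and $a+a'=n$. A subset $B\subseteq A$ is a minimal asymptotic basis if $B$ is an asymptotic basis but no proper subset of $B$ is an asymptotic basis. *)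

theory Defs
  imports Complex_Main
begin

definition asymptotic_basis :: "nat set \<Rightarrow> bool" where
  "asymptotic_basis A \<longleftrightarrow>
     (\<exists>n0. \<forall>n>n0. \<exists>a\<in>A. \<exists>a'\<in>A. a \<le> a' \<and> n = a + a')"

(* The set of pairs is finite for every n, since both components are at most n. *)
definition rep :: "nat set \<Rightarrow> nat \<Rightarrow> nat" where
  "rep A n = card {(a, a'). a \<in> A \<and> a' \<in> A \<and> a \<le> a' \<and> a + a' = n}"

definition minimal_asymptotic_basis :: "nat set \<Rightarrow> bool" where
  "minimal_asymptotic_basis B \<longleftrightarrow>
     asymptotic_basis B \<and> (\<forall>B'. B' \<subset> B \<longrightarrow> \<not> asymptotic_basis B')"

definition rep_tends_to_infinity :: "nat set \<Rightarrow> bool" where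
  "rep_tends_to_infinity A \<longleftrightarrow> filterlim (rep A) at_top sequentially"

definition splits_into_two_bases :: "nat set \<Rightarrow> bool" where
  "splits_into_two_bases A \<longleftrightarrow>
     (\<exists>B C. A = B \<union> C \<and> B \<inter> C = {} \<and> asymptotic_basis B \<and> asymptotic_basis C)"

definition contains_minimal_basis :: "nat set \<Rightarrow> bool" where
  "contains_minimal_basis A \<longleftrightarrow> (\<exists>B\<subseteq>A. minimal_asymptotic_basis B)"

end

(* The bases are built around a sparse sequence of special numbers whose representations are
   prescribed exactly: the representations of "special k" are the pairs (f, special k - f) with f in
   a finite set "chosen k" of previously built elements, while every other large n has many
   representations in each of two colour classes. So whether a subset of the basis is again
   a basis is decided by the chosen sets, as soon as the subset misses few elements.

   If the chosen sets run over all sufficiently large sets avoiding longer and longer initial segments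
   ("balanced_choice"), then every sub-basis contains almost all of one colour class, while each
   element takes part in only finitely many special numbers; so no element is ever indispensable and
   there is no minimal sub-basis. If each element of one class is infinitely often the only
   chosen element of its class ("critical_choice"), that class is itself a minimal basis. *)

theory Submission
  imports Defs "HOL-Library.Nat_Bijection"
begin

section \<open>A single zone\<close>

text \<open>Both {0, 1, 3, 4} and its complement {2, 5, 6, 7} reach every residue modulo 8 as a sum
  of two of their elements, so neither colour is privileged.\<close>

definition hue :: "nat \<Rightarrow> bool" where
  "hue x \<longleftrightarrow> x mod 8 \<in> {0, 1, 3, 4}"

lemma hue_sum:
  assumes "u + 7 \<le> m"
  shows "\<exists>x. u \<le> x \<and> x < u + 8 \<and> hue x = c \<and> hue (m - x) = c"
proof -
  \<comment> \<open>The table lists, for each residue of \<open>m\<close>, a residue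
    \<open>s\<close> of colour \<open>c\<close> such that \<open>m - s\<close> modulo 8 has colour
    \<open>c\<close> too.\<close>
  define s :: nat where "s = (if c then [0, 0, 1, 0, 0, 1, 3, 3] else [2, 2, 5, 5, 2, 6, 7, 2]) ! (m mod 8)"
  have "s < 8 \<and> (s \<in> {0, 1, 3, 4}) = c \<and> ((m mod 8 + 8 - s) mod 8 \<in> {0, 1, 3, 4}) = c"
  proof -
    have "m mod 8 < 8" by simp
    then consider "m mod 8 = 0" | "m mod 8 = 1" | "m mod 8 = 2" | "m mod 8 = 3"
      | "m mod 8 = 4" | "m mod 8 = 5" | "m mod 8 = 6" | "m mod 8 = 7" by linarith
    then show ?thesis unfolding s_def by cases (cases c; simp)+
  qed
  note s = conjunct1[OF this] conjunct1[OF conjunct2[OF this]] conjunct2[OF conjunct2[OF this]]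
  \<comment> \<open>The first number from \<open>u\<close> on with residue \<open>s\<close>.\<close>
  define x where "x = u + (s + 8 - u mod 8) mod 8"
  have x: "u \<le> x" "x < u + 8" by (auto simp: x_def)
  have "x mod 8 = (u mod 8 + (s + 8 - u mod 8)) mod 8"
    unfolding x_def by (simp only: mod_add_left_eq mod_add_right_eq)
  also have "u mod 8 + (s + 8 - u mod 8) = s + 8"
    using mod_less_divisor[of 8 u] by linarith
  finally have xs: "x mod 8 = s" using s(1) by simp
  have "x \<le> m" using x assms by linarith
  have *: "\<mu> + 8 - s + 8 * b = (8 * b + \<mu>) - (8 * a + s) + 8 * (a + 1)"
    if "8 * a + s \<le> 8 * b + \<mu>" for a b \<mu> using that s(1) by (simp add: algebra_simps)
  have "m mod 8 + 8 - s + 8 * (m div 8) = (m - x) + 8 * (x div 8 + 1)"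
    using mult_div_mod_eq[of 8 m] mult_div_mod_eq[of 8 x] xs \<open>x \<le> m\<close> *[of "x div 8" "m div 8" "m mod 8"] by (simp only:)
  then have "(m mod 8 + 8 - s + 8 * (m div 8)) mod 8 = ((m - x) + 8 * (x div 8 + 1)) mod 8"
    by (rule arg_cong)
  then have "(m - x) mod 8 = (m mod 8 + 8 - s) mod 8"
    by (simp only: mod_mult_self2)
  then have "hue x = c" "hue (m - x) = c" using s xs unfolding hue_def by (simp_all only:)
  then show ?thesis using x by blast
qed

text \<open>Both colour classes are additive bases modulo 8, so long intervals of one colour have sums of all residues.\<close>

lemma card_solid_sums:
  fixes a b a' b' m R :: nat
  assumes X: "\<And>x. a \<le> x \<Longrightarrow> x < b \<Longrightarrow> hue x = c \<Longrightarrow> x \<in> X"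
    and Y: "\<And>x. a' \<le> x \<Longrightarrow> x < b' \<Longrightarrow> hue x = c \<Longrightarrow> x \<in> Y"
    and m: "a + a' + 8 * R \<le> m" "m + 8 * R + 1 \<le> b + b'" "a + 8 * R \<le> b" "a' + 8 * R \<le> b'"
  shows "R \<le> card {x \<in> X. x \<le> m \<and> m - x \<in> Y}"
proof -
  \<comment> \<open>The least start that keeps \<open>x\<close> at or above \<open>a\<close> and
    \<open>m - x\<close> below \<open>b'\<close>. Each of the \<open>R\<close> consecutive windows
    of length 8 from there gives one summand.\<close>
  define u where "u = max a (m + 1 - b')"
  have "\<exists>x. u + 8 * i \<le> x \<and> x < u + 8 * i + 8 \<and> hue x = c \<and> hue (m - x) = c" if "i < R" for i
    by (rule hue_sum) (use that m in \<open>auto simp: u_def\<close>)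
  then obtain g where g: "\<And>i. i < R \<Longrightarrow> u + 8 * i \<le> g i \<and> g i < u + 8 * i + 8 \<and> hue (g i) = c \<and> hue (m - g i) = c"
    by metis
  have inj: "inj_on g {..<R}"
  proof (rule inj_onI)
    fix i j assume "i \<in> {..<R}" "j \<in> {..<R}" "g i = g j"
    then show "i = j" using g[of i] g[of j] by auto
  qed
  have "g ` {..<R} \<subseteq> {x \<in> X. x \<le> m \<and> m - x \<in> Y}"
  proof
    fix x assume "x \<in> g ` {..<R}"
    then obtain i where i: "i < R" "x = g i" by auto
    have r: "u \<le> x" "x + 1 \<le> u + 8 * R" using g[OF i(1)] i by auto
    have "a \<le> x" "x < b" "x \<le> m" "a' \<le> m - x" "m - x < b'"
      using r m by (auto simp: u_def max_def split: if_splits)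
    then show "x \<in> {x \<in> X. x \<le> m \<and> m - x \<in> Y}" using X Y g[OF i(1)] i by blast
  qed
  moreover have "finite {x \<in> X. x \<le> m \<and> m - x \<in> Y}" by (rule finite_subset[of _ "{..m}"]) auto
  ultimately have "card (g ` {..<R}) \<le> card {x \<in> X. x \<le> m \<and> m - x \<in> Y}" by (rule card_mono[rotated])
  then show ?thesis using card_image[OF inj] by simp
qed

text \<open>A zone is a finite set without two elements summing to \<open>120 * N\<^sup>2\<close>: of \<open>x\<close> and \<open>120 * N\<^sup>2 - x\<close>
  at most one is taken. Solid intervals yield the sums far from \<open>120 * N\<^sup>2\<close>. Between them the lower and
  the upper partner are chosen alternately, on blocks of length \<open>4 * N\<close>: each change of choice
  contributes one representation of every \<open>120 * N\<^sup>2 \<plusminus> d\<close> with \<open>0 < d \<le> 4 * N\<close>.\<close>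

definition blocks :: "nat \<Rightarrow> bool \<Rightarrow> bool \<Rightarrow> nat set" where
  "blocks N c e = {x. \<exists>i r. i < 2 * N \<and> r < 4 * N \<and> even i = e \<and>
     x = (if c then 20 else 28) * N\<^sup>2 + 4 * N * i + r}"

definition zone :: "nat \<Rightarrow> bool \<Rightarrow> nat set" where
  "zone N c = {x. hue x = c \<and> (N \<le> x \<and> x < 20 * N\<^sup>2 \<or> 36 * N\<^sup>2 \<le> x \<and> x < 60 * N\<^sup>2)} \<union>
     blocks N c True \<union> (\<lambda>x. 120 * N\<^sup>2 - x) ` blocks N c False"

lemma block_bounds:
  assumes "x \<in> blocks N c e"
  shows "(if c then 20 else 28) * N\<^sup>2 \<le> x" "x < (if c then 28 else 36) * N\<^sup>2"
proof -
  obtain i r where i: "i < 2 * N" "r < 4 * N" "x = (if c then 20 else 28) * N\<^sup>2 + 4 * N * i + r"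
    using assms unfolding blocks_def by blast
  have "4 * N * (i + 1) \<le> 4 * N * (2 * N)" using i(1) by (intro mult_le_mono2) simp
  then have "4 * N * i + 4 * N \<le> 8 * N\<^sup>2" by (simp add: power2_eq_square algebra_simps)
  then show "(if c then 20 else 28) * N\<^sup>2 \<le> x" "x < (if c then 28 else 36) * N\<^sup>2"
    using i by (auto split: if_splits)
qed

lemma block_unique:
  fixes N i j r s :: nat
  assumes "4 * N * i + r = 4 * N * j + s" "r < 4 * N" "s < 4 * N"
  shows "i = j"
proof -
  have "(4 * N * k + t) div (4 * N) = k" if "t < 4 * N" for k t
    using that by (simp add: div_mult_self4)
  then show ?thesis using assms by metis
qed

lemma blocks_disjoint:
  assumes "x \<in> blocks N c e" "x \<in> blocks N c' e'"
  shows "c = c' \<and> e = e'"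
proof -
  have c: "c = c'"
    using block_bounds[OF assms(1)] block_bounds[OF assms(2)] by (auto split: if_splits)
  obtain i r where i: "r < 4 * N" "even i = e" "x = (if c then 20 else 28) * N\<^sup>2 + 4 * N * i + r"
    using assms(1) unfolding blocks_def by blast
  obtain j s where j: "s < 4 * N" "even j = e'" "x = (if c then 20 else 28) * N\<^sup>2 + 4 * N * j + s"
    using assms(2) c unfolding blocks_def by blast
  have "i = j" using block_unique[of N i r j s] i j by simp
  then show ?thesis using i j c by simp
qed

text \<open>A reflected element is named through its lower partner \<open>z\<close>, which replaces
  truncated subtraction by an equation.\<close>

lemma zone_cases:
  assumes "x \<in> zone N c"
  obtains (solid) "hue x = c" "N \<le> x" "x < 20 * N\<^sup>2 \<or> 36 * N\<^sup>2 \<le> x" "x < 60 * N\<^sup>2"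
  | (low) "x \<in> blocks N c True" "20 * N\<^sup>2 \<le> x" "x < 36 * N\<^sup>2"
  | (high) z where "z \<in> blocks N c False" "x + z = 120 * N\<^sup>2" "20 * N\<^sup>2 \<le> z" "z < 36 * N\<^sup>2"
proof -
  consider "hue x = c \<and> (N \<le> x \<and> x < 20 * N\<^sup>2 \<or> 36 * N\<^sup>2 \<le> x \<and> x < 60 * N\<^sup>2)"
    | "x \<in> blocks N c True" | z where "z \<in> blocks N c False" "x = 120 * N\<^sup>2 - z"
    using assms unfolding zone_def by blast
  then show ?thesis
  proof cases
    case 1
    moreover have "N \<le> N\<^sup>2" by (simp add: power2_eq_square)
    ultimately show ?thesis using solid by linarith
  next
    case 2
    then show ?thesis using low block_bounds[OF 2] by (auto split: if_splits)
  next
    case 3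
    then show ?thesis using high[of z] block_bounds[OF 3(1)] by (auto split: if_splits)
  qed
qed

lemma zone_bounds:
  assumes "x \<in> zone N c"
  shows "N \<le> x" "x \<le> 100 * N\<^sup>2"
proof -
  have N: "N \<le> N\<^sup>2" by (simp add: power2_eq_square)
  show "N \<le> x" using assms by (cases rule: zone_cases) (use N in linarith)+
  show "x \<le> 100 * N\<^sup>2" using assms by (cases rule: zone_cases) linarith+
qed

text \<open>The solid parts differ in hue, and the blocks of the two colours fill disjoint ranges,
  one below and one from \<open>28 * N^2\<close> on.\<close>

lemma zone_disjoint: 
  assumes "x \<in> zone N c" "x \<in> zone N c'"
  shows "c = c'"
  using assms(1)
proof (cases rule: zone_cases)
  case x: solid
  show ?thesis using assms(2) by (cases rule: zone_cases) (use x in \<open>linarith | simp\<close>)+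
next
  case x: low
  show ?thesis using assms(2)
  proof (cases rule: zone_cases)
    case low
    then show ?thesis using x blocks_disjoint by blast
  qed (use x in linarith)+
next
  case x: (high z)
  show ?thesis using assms(2) 
  proof (cases rule: zone_cases)
    case (high y)
    have "y = z" using high(2) x(2) by linarith
    then show ?thesis using high(1) x(1) blocks_disjoint by blast
  qed (use x in linarith)+
qed

text \<open>The two colours may differ. As \<open>60 * N^2\<close> is not taken, one summand is
  smaller and the other larger; the larger one is the reflection of a number in an odd block, and
  the numbers of odd blocks themselves are in neither zone.\<close>

lemma zone_sum_neq: 
  assumes "x \<in> zone N c" "y \<in> zone N c'"
  shows "x + y \<noteq> 120 * N\<^sup>2"
proof 
  assume s: "x + y = 120 * N\<^sup>2"
  have no: False if low: "x < 60 * N\<^sup>2" and x: "x \<in> zone N c" and y: "y \<in> zone N c'"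
    and s: "x + y = 120 * N\<^sup>2" for x y c c'
    using y
  proof (cases rule: zone_cases)
    case z: (high z)
    then have "z = x" using s by linarith
    with z have z: "x \<in> blocks N c' False" "20 * N\<^sup>2 \<le> x" "x < 36 * N\<^sup>2" by auto
    show False using x
      by (cases rule: zone_cases) (use z blocks_disjoint[OF z(1)] in auto)
  qed (use low s in auto)
  show False
  proof (cases "x < 60 * N\<^sup>2 \<or> y < 60 * N\<^sup>2")
    case True
    then show ?thesis using no[of x c y c'] no[of y c' x c] assms s by (auto simp: add.commute)
  next
    case False
    then have "x = 60 * N\<^sup>2" using s by linarith
    show ?thesis using assms(1) by (cases rule: zone_cases) (use \<open>x = 60 * N\<^sup>2\<close> in auto)
  qed
qed

lemma zone_solid:
  assumes "hue x = c" "N \<le> x" "x < 20 * N\<^sup>2 \<or> 36 * N\<^sup>2 \<le> x" "x < 60 * N\<^sup>2"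
  shows "x \<in> zone N c"
  using assms by (auto simp: zone_def)

text \<open>Bridges the gap between the sums controlled inside one zone, up to shortly after
  \<open>120 * N^2\<close>, and those inside the next, from \<open>3 * N'\<close> on.\<close>

lemma zone_sums_cross:
  assumes "16 * R \<le> N" "N \<le> N'" "16 \<le> N" "N + N' + 8 * R \<le> m" "m \<le> 4 * N'"
  shows "R \<le> card {x \<in> zone N c. x \<le> m \<and> m - x \<in> zone N' c}"
proof (rule card_solid_sums[where c = c and a = N and b = "20 * N\<^sup>2" and a' = N' and b' = "20 * N'\<^sup>2"])
  have "N \<le> N\<^sup>2" "N' \<le> N'\<^sup>2" by (simp_all add: power2_eq_square)
  then show "m + 8 * R + 1 \<le> 20 * N\<^sup>2 + 20 * N'\<^sup>2" "N + 8 * R \<le> 20 * N\<^sup>2" "N' + 8 * R \<le> 20 * N'\<^sup>2" 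
    using assms by linarith+
qed (use assms in \<open>auto intro: zone_solid\<close>)

lemma zone_sums_near_above:
  fixes N d :: nat
  assumes "1 \<le> d" "d \<le> 4 * N" 
  shows "N - 1 \<le> card {x \<in> zone N c. x \<le> 120 * N\<^sup>2 + d \<and> 120 * N\<^sup>2 + d - x \<in> zone N c}"
    (is "_ \<le> card ?Z")
proof -
  define p :: nat where "p = (if c then 20 else 28) * N\<^sup>2"
  define g where "g = (\<lambda>j. p + 4 * N * (2 * j + 2))"
  have N: "N > 0" using assms by auto
  have "g ` {..<N - 1} \<subseteq> ?Z"
  proof
    fix x assume "x \<in> g ` {..<N - 1}"
    then obtain j where j: "j < N - 1" "x = p + 4 * N * (2 * j + 2)" by (auto simp: g_def)
    \<comment> \<open>\<open>x\<close> is the first number of the even block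
      \<open>2 * j + 2\<close>. Since \<open>1 \<le> d \<le> 4 * N\<close>, \<open>x - d\<close>
      falls into the odd block just before, which enters the zone reflected. Block
      \<open>2 * j + 2\<close> has to be among the \<open>2 * N\<close> blocks, hence the count
      \<open>N - 1\<close>.\<close>
    have x: "x \<in> blocks N c True" unfolding blocks_def mem_Collect_eq
      by (rule exI[of _ "2 * j + 2"], rule exI[of _ 0]) (use j N in \<open>auto simp: p_def\<close>)
    have y: "x - d \<in> blocks N c False" unfolding blocks_def mem_Collect_eq
      by (rule exI[of _ "2 * j + 1"], rule exI[of _ "4 * N - d"])
         (use j N assms in \<open>auto simp: p_def algebra_simps\<close>)
    have b: "x < 36 * N\<^sup>2" using block_bounds[OF x] by (auto split: if_splits)
    have dx: "d \<le> x" using assms j by (auto simp: algebra_simps)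
    have "120 * N\<^sup>2 + d - x = 120 * N\<^sup>2 - (x - d)" using dx by simp
    then have "120 * N\<^sup>2 + d - x \<in> zone N c" using y unfolding zone_def by blast
    moreover have "x \<in> zone N c" using x unfolding zone_def by blast
    moreover have "x \<le> 120 * N\<^sup>2 + d" using b by linarith
    ultimately show "x \<in> ?Z" by blast
  qed
  moreover have "inj_on g {..<N - 1}" using N by (auto simp: g_def inj_on_def)
  moreover have "finite ?Z" by (rule finite_subset[of _ "{..120 * N\<^sup>2 + d}"]) auto
  ultimately show ?thesis using card_mono[of ?Z "g ` {..<N - 1}"] card_image[of g "{..<N - 1}"] by simp
qed

lemma zone_sums_near_below:
  fixes N d :: nat
  assumes "1 \<le> d" "d \<le> 4 * N" 
  shows "N \<le> card {x \<in> zone N c. x \<le> 120 * N\<^sup>2 - d \<and> 120 * N\<^sup>2 - d - x \<in> zone N c}"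
    (is "_ \<le> card ?Z")
proof -
  define p :: nat where "p = (if c then 20 else 28) * N\<^sup>2"
  define g where "g = (\<lambda>j. p + (4 * N - 1) + 4 * N * (2 * j))"
  have N: "N > 0" using assms by auto
  have "g ` {..<N} \<subseteq> ?Z"
  proof
    fix x assume "x \<in> g ` {..<N}"
    then obtain j where j: "j < N" "x = p + (4 * N - 1) + 4 * N * (2 * j)" by (auto simp: g_def)
    \<comment> \<open>Here \<open>x\<close> is the last number of the even block
      \<open>2 * j\<close>, and \<open>x + d\<close> falls into the odd block just after it.\<close>
    have x: "x \<in> blocks N c True" unfolding blocks_def mem_Collect_eq
      by (rule exI[of _ "2 * j"], rule exI[of _ "4 * N - 1"]) (use j N in \<open>auto simp: p_def\<close>)
    have y: "x + d \<in> blocks N c False" unfolding blocks_def mem_Collect_eq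
      by (rule exI[of _ "2 * j + 1"], rule exI[of _ "d - 1"])
         (use j N assms in \<open>auto simp: p_def algebra_simps\<close>)
    have b: "x + d < 36 * N\<^sup>2" using block_bounds[OF y] by (auto split: if_splits)
    have "120 * N\<^sup>2 - d - x = 120 * N\<^sup>2 - (x + d)" by simp
    then have "120 * N\<^sup>2 - d - x \<in> zone N c" using y unfolding zone_def by blast
    moreover have "x \<in> zone N c" using x unfolding zone_def by blast
    moreover have "x \<le> 120 * N\<^sup>2 - d" using b by linarith
    ultimately show "x \<in> ?Z" by blast
  qed
  moreover have "inj_on g {..<N}" using N by (simp only: inj_on_def g_def add_left_cancel) simp
  moreover have "finite ?Z" by (rule finite_subset[of _ "{..120 * N\<^sup>2 - d}"]) auto
  ultimately show ?thesis using card_mono[of ?Z "g ` {..<N}"] card_image[of g "{..<N}"] by simp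
qed

lemma zone_sums:
  assumes R: "16 * R \<le> N" "16 \<le> N" and m: "3 * N \<le> m" "m \<le> 120 * N\<^sup>2 + 4 * N" "m \<noteq> 120 * N\<^sup>2"
  shows "R \<le> card {x \<in> zone N c. x \<le> m \<and> m - x \<in> zone N c}"
proof -
  have "16 * N \<le> N\<^sup>2" using R by (simp add: power2_eq_square)
  note N = this R
  \<comment> \<open>The two solid intervals, added to themselves and to each other, give the first
    three ranges. What remains lies within \<open>4 * N\<close> of \<open>120 * N^2\<close>, where
    the alternating blocks take over.\<close>
  consider "m + N \<le> 40 * N\<^sup>2" | "37 * N\<^sup>2 \<le> m" "m \<le> 79 * N\<^sup>2" | "73 * N\<^sup>2 \<le> m" "m + 8 * R + 1 \<le> 120 * N\<^sup>2"
    | "120 * N\<^sup>2 < m" | "120 * N\<^sup>2 < m + 8 * R + 1" "m < 120 * N\<^sup>2" using N m by linarith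
  then show ?thesis
  proof cases
    case 1
    show ?thesis
      by (rule card_solid_sums[where c = c and a = N and b = "20 * N\<^sup>2" and a' = N and b' = "20 * N\<^sup>2"])
        (use N m 1 in \<open>auto intro: zone_solid\<close>)
  next
    case 2
    show ?thesis
      by (rule card_solid_sums[where c = c and a = N and b = "20 * N\<^sup>2" and a' = "36 * N\<^sup>2" and b' = "60 * N\<^sup>2"])
        (use N m 2 in \<open>auto intro: zone_solid\<close>)
  next
    case 3
    show ?thesis
      by (rule card_solid_sums[where c = c and a = "36 * N\<^sup>2" and b = "60 * N\<^sup>2" and a' = "36 * N\<^sup>2" and b' = "60 * N\<^sup>2"])
        (use N m 3 in \<open>auto intro: zone_solid\<close>)
  next
    case 4
    show ?thesis using order_trans[OF _ zone_sums_near_above[of "m - 120 * N\<^sup>2" N c], of R] 4 m R by simp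
  next
    case 5
    show ?thesis using order_trans[OF _ zone_sums_near_below[of "120 * N\<^sup>2 - m" N c], of R] 5 m R by simp
  qed
qed

section \<open>Bases with prescribed representations of the special numbers\<close>

primrec bound :: "nat \<Rightarrow> nat" where
  "bound 0 = 16"
| "bound (Suc k) = 120 * (bound k)\<^sup>2 + 1"

definition special :: "nat \<Rightarrow> nat" where
  "special k = 120 * (bound k)\<^sup>2"

text \<open>The offset 1 puts every summand of \<open>special k\<close> below
  \<open>bound (Suc k)\<close>, so the representations of \<open>special k\<close> are settled once
  \<open>part (Suc k)\<close> is built.\<close>

lemma bound_Suc: "bound (Suc k) = special k + 1"
  by (simp add: special_def)

lemma bound_le_square: "16 * bound k \<le> (bound k)\<^sup>2" "16 \<le> bound k"
proof -
  show *: "16 \<le> bound k"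
  proof (induction k)
    case (Suc k)
    then have "bound k \<le> (bound k)\<^sup>2" by (simp add: power2_eq_square)
    with Suc show ?case by simp
  qed simp
  then show "16 * bound k \<le> (bound k)\<^sup>2" by (simp add: power2_eq_square)
qed

text \<open>Fast enough growth to use \<open>R = 100 * k\<close> in the zone lemmas at scale
  \<open>bound k\<close>, which ask for \<open>16 * R \<le> bound k\<close>.\<close>

lemma bound_ge: "1600 * k \<le> bound k"
proof (induction k)
  case (Suc k)
  then show ?case using bound_le_square[of k] by simp
qed simp

lemma bound_mono: "k \<le> l \<Longrightarrow> bound k \<le> bound l"
  by (rule lift_Suc_mono_le[of bound]) (use bound_le_square in \<open>simp add: le_Suc_eq trans_le_add1 power2_eq_square\<close>)

lemma special_ge: "k \<le> special k"
  using bound_ge[of k] bound_le_square[of k] by (simp add: special_def)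

declare bound.simps(2) [simp del]

lemma level_exists:
  assumes "3 * bound K \<le> m"
  obtains k where "K \<le> k" "3 * bound k \<le> m" "m < 3 * bound (Suc k)"
proof -
  have "\<exists>k>K. m < 3 * bound k"
    using bound_ge[of "K + Suc m"] by (intro exI[of _ "K + Suc m"]) auto
  then have ex: "\<exists>j. m < 3 * bound (K + Suc j)" by (metis add_Suc_right less_iff_Suc_add)
  define j where "j = (LEAST j. m < 3 * bound (K + Suc j))"
  have 1: "m < 3 * bound (Suc (K + j))" using LeastI_ex[OF ex] by (simp add: j_def)
  have 2: "3 * bound (K + j) \<le> m"
  proof (cases j)
    case (Suc i)
    then have "\<not> m < 3 * bound (K + Suc i)" using not_less_Least[of i "\<lambda>j. m < 3 * bound (K + Suc j)"]
      unfolding j_def by simp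
    then show ?thesis using Suc by simp
  qed (use assms in simp)
  show ?thesis using that[of "K + j"] 1 2 by simp
qed

text \<open>Level \<open>k\<close> starts at \<open>3 * bound k\<close> because a zone at scale
  \<open>N\<close> controls sums from \<open>3 * N\<close> on. Consecutive levels leave no
  gap.\<close>

lemma eventually_levelwise:
  assumes "\<forall>\<^sub>F k in sequentially. \<forall>m. 3 * bound k \<le> m \<longrightarrow> m < 3 * bound (Suc k) \<longrightarrow>
      m \<notin> range special \<longrightarrow> P m"
    and "\<forall>\<^sub>F k in sequentially. P (special k)"
  shows "\<forall>\<^sub>F m in sequentially. P m"
proof -
  obtain K where K: "\<And>k m. K \<le> k \<Longrightarrow> 3 * bound k \<le> m \<Longrightarrow> m < 3 * bound (Suc k) \<Longrightarrow>
      m \<notin> range special \<Longrightarrow> P m" "\<And>k. K \<le> k \<Longrightarrow> P (special k)"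
    using eventually_conj[OF assms] unfolding eventually_sequentially by blast
  have "P m" if m: "3 * bound K \<le> m" for m
  proof (cases "m \<in> range special")
    case True
    then obtain k where k: "m = special k" by auto
    have "K \<le> k"
    proof (rule ccontr)
      assume "\<not> K \<le> k"
      then have "bound (Suc k) \<le> bound K" by (intro bound_mono) simp
      then show False using m k bound_Suc[of k] by simp
    qed
    then show ?thesis using K(2) k by simp
  next
    case False
    then show ?thesis using level_exists[OF m] K(1) by metis
  qed
  then show ?thesis unfolding eventually_sequentially by blast
qed

section \<open>Representability and counting of summands\<close>

definition represents :: "nat set \<Rightarrow> nat \<Rightarrow> bool" where
  "represents D n \<longleftrightarrow> (\<exists>a\<in>D. \<exists>a'\<in>D. a \<le> a' \<and> n = a + a')"

lemma asymptotic_basis_iff: "asymptotic_basis D \<longleftrightarrow> (\<forall>\<^sub>F n in sequentially. represents D n)"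
  by (simp add: asymptotic_basis_def represents_def eventually_at_top_dense)

lemma represents_mono: "represents D n \<Longrightarrow> D \<subseteq> E \<Longrightarrow> represents E n"
  unfolding represents_def by blast

lemma asymptotic_basis_mono: "asymptotic_basis D \<Longrightarrow> D \<subseteq> E \<Longrightarrow> asymptotic_basis E"
  unfolding asymptotic_basis_iff by (erule eventually_mono) (rule represents_mono)

lemma finite_rep_pairs: "finite {(a, a'). a \<in> A \<and> a' \<in> A \<and> a \<le> a' \<and> a + a' = (n::nat)}"
  by (rule finite_subset[of _ "{..n} \<times> {..n}"]) auto

lemma card_summands_le_rep: "card {x \<in> A. x \<le> n \<and> n - x \<in> A} \<le> 2 * rep A n"
proof -
  let ?P = "{(a, a'). a \<in> A \<and> a' \<in> A \<and> a \<le> a' \<and> a + a' = n}"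
  have sub: "x \<in> fst ` ?P \<union> snd ` ?P" if "x \<in> A" "x \<le> n" "n - x \<in> A" for x
  proof (cases "x \<le> n - x")
    case True
    then have "(x, n - x) \<in> ?P" using that by simp
    from imageI[OF this, of fst] show ?thesis by (simp only: fst_conv Un_iff simp_thms)
  next
    case False
    then have "(n - x, x) \<in> ?P" using that by simp
    from imageI[OF this, of snd] show ?thesis by (simp only: snd_conv Un_iff simp_thms)
  qed
  have "card {x \<in> A. x \<le> n \<and> n - x \<in> A} \<le> card (fst ` ?P \<union> snd ` ?P)"
  proof (rule card_mono)
    show "finite (fst ` ?P \<union> snd ` ?P)" by (intro finite_UnI finite_imageI finite_rep_pairs)
    show "{x \<in> A. x \<le> n \<and> n - x \<in> A} \<subseteq> fst ` ?P \<union> snd ` ?P" by (rule subsetI, rule sub) auto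
  qed
  also have "\<dots> \<le> card (fst ` ?P) + card (snd ` ?P)" by (rule card_Un_le)
  also have "\<dots> \<le> card ?P + card ?P" by (intro add_mono card_image_le finite_rep_pairs)
  finally show ?thesis by (simp add: rep_def)
qed

text \<open>A missing element \<open>y\<close> spoils at most the two summands \<open>y\<close> and
  \<open>m - y\<close>.\<close>

lemma represents_if_few_missing:
  assumes "2 * card ((X - D) \<inter> {..m}) < card {x \<in> X. x \<le> m \<and> m - x \<in> X}"
  shows "represents D m"
proof (rule ccontr)
  assume no: "\<not> represents D m"
  let ?M = "(X - D) \<inter> {..m}"
  have "{x \<in> X. x \<le> m \<and> m - x \<in> X} \<subseteq> ?M \<union> (\<lambda>y. m - y) ` ?M"
  proof
    fix x assume x: "x \<in> {x \<in> X. x \<le> m \<and> m - x \<in> X}"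
    have "\<not> (x \<in> D \<and> m - x \<in> D)"
    proof
      assume *: "x \<in> D \<and> m - x \<in> D"
      show False
      proof (cases "x \<le> m - x")
        case True
        then show ?thesis using no * x unfolding represents_def by force
      next
        case False
        moreover from this have "m - x \<le> x" "m = (m - x) + x" using x by auto
        ultimately show ?thesis using no * x unfolding represents_def by blast
      qed
    qed
    then have "x \<in> ?M \<or> m - x \<in> ?M" using x by auto
    moreover have "x = m - (m - x)" using x by simp
    ultimately show "x \<in> ?M \<union> (\<lambda>y. m - y) ` ?M" by blast
  qed
  then have "card {x \<in> X. x \<le> m \<and> m - x \<in> X} \<le> card (?M \<union> (\<lambda>y. m - y) ` ?M)"
    by (intro card_mono) auto
  also have "\<dots> \<le> card ?M + card ((\<lambda>y. m - y) ` ?M)" by (rule card_Un_le)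
  also have "\<dots> \<le> card ?M + card ?M" by (intro add_mono card_image_le) auto
  finally show False using assms by simp
qed

section \<open>The staged construction, with the selection rule as parameter\<close>

locale construction =
  fixes sel :: "nat \<Rightarrow> (bool \<Rightarrow> nat set) \<Rightarrow> nat set"
begin

text \<open>A partner \<open>special k - f\<close> inherits the colour of \<open>f\<close>, so the
  classes stay disjoint and special numbers get no representation of mixed colour. Intersecting with
  \<open>part k c\<close> admits every rule \<open>sel\<close>, even one with infinite
  values.\<close>

primrec part :: "nat \<Rightarrow> bool \<Rightarrow> nat set" where
  "part 0 = (\<lambda>c. {})"
| "part (Suc k) = (\<lambda>c. part k c \<union> zone (bound k) c \<union>
     (\<lambda>f. special k - f) ` (sel k (part k) \<inter> part k c))"

definition chosen :: "nat \<Rightarrow> nat set" where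
  "chosen k = sel k (part k) \<inter> (part k True \<union> part k False)"

definition whole :: "bool \<Rightarrow> nat set" where
  "whole c = (\<Union>k. part k c)"

lemma part_less: "x \<in> part k c \<Longrightarrow> x < bound k"
proof (induction k)
  case (Suc k)
  have "bound k \<le> special k" using bound_le_square[of k] by (simp add: special_def)
  then show ?case using Suc zone_bounds[of x "bound k" c] bound_Suc[of k] special_def[of k]
    by fastforce
qed simp

text \<open>The three layers lie in separate ranges: the zone is above the old elements, and the
  partners of old elements are above the zone. Mixed cases then fall to linear arithmetic.\<close>

lemma part_Suc_cases:
  assumes "x \<in> part (Suc k) c"
  obtains (old) "x \<in> part k c" "x < bound k"
  | (zone) "x \<in> zone (bound k) c" "bound k \<le> x" "x \<le> 100 * (bound k)\<^sup>2"
  | (high) f where "f \<in> chosen k" "f \<in> part k c" "x + f = special k" "f < bound k"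
      "100 * (bound k)\<^sup>2 + bound k < x"
proof -
  consider "x \<in> part k c" | "x \<in> zone (bound k) c"
    | f where "f \<in> sel k (part k)" "f \<in> part k c" "x = special k - f"
    using assms by auto
  then show ?thesis
  proof cases
    case 1
    then show ?thesis using old part_less by blast
  next
    case 2
    then show ?thesis using zone zone_bounds by blast
  next
    case 3
    have f: "f < bound k" using part_less 3 by blast
    moreover have "x + f = special k" "100 * (bound k)\<^sup>2 + bound k < x"
      using f 3 bound_le_square[of k] by (auto simp: special_def)
    moreover have "f \<in> chosen k" using 3 unfolding chosen_def by (cases c) auto
    ultimately show ?thesis using high 3 by blast
  qed
qed

lemma part_mono: "k \<le> l \<Longrightarrow> part k c \<subseteq> part l c"
  by (rule lift_Suc_mono_le[of "\<lambda>k. part k c"]) auto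

text \<open>Everything added from stage \<open>k\<close> on is at least
  \<open>bound k\<close>.\<close>

lemma part_old:
  assumes "x \<in> part (k + j) c" "x < bound k"
  shows "x \<in> part k c"
  using assms(1)
proof (induction j)
  case (Suc j)
  have "bound k \<le> bound (k + j)" by (rule bound_mono) simp
  from Suc.prems have "x \<in> part (Suc (k + j)) c" by simp
  then show ?case
  proof (cases rule: part_Suc_cases)
    case old
    then show ?thesis using Suc.IH by blast
  qed (use assms(2) \<open>bound k \<le> bound (k + j)\<close> in linarith)+
qed simp

lemma whole_below: "whole c \<inter> {..<bound k} = part k c"
proof
  show "whole c \<inter> {..<bound k} \<subseteq> part k c"
  proof
    fix x assume "x \<in> whole c \<inter> {..<bound k}"
    then obtain l where l: "x \<in> part l c" "x < bound k" by (auto simp: whole_def)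
    then have "x \<in> part (k + l) c" using part_mono[of l "k + l" c] by auto
    then show "x \<in> part k c" using part_old l by blast
  qed
  show "part k c \<subseteq> whole c \<inter> {..<bound k}" using part_less by (auto simp: whole_def)
qed

lemma in_part_if_less: "x \<in> whole c \<Longrightarrow> x < bound k \<Longrightarrow> x \<in> part k c"
  using whole_below by blast

lemma part_subset_whole: "part k c \<subseteq> whole c"
  by (auto simp: whole_def)

lemma zone_subset_part: "zone (bound k) c \<subseteq> part (Suc k) c"
  by auto

lemma zone_subset_whole: "zone (bound k) c \<subseteq> whole c"
  using zone_subset_part part_subset_whole by blast

lemma finite_part: "finite (part k c)"
  by (rule finite_subset[of _ "{..<bound k}"]) (use part_less in auto)

lemma part_disjoint: "x \<in> part k c \<Longrightarrow> x \<in> part k c' \<Longrightarrow> c = c'"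
proof (induction k arbitrary: x)
  case (Suc k)
  show ?case using Suc.prems(1)
  proof (cases rule: part_Suc_cases)
    case x: old
    show ?thesis using Suc.prems(2)
    proof (cases rule: part_Suc_cases)
      case old
      then show ?thesis using x Suc.IH by blast
    qed (use x in linarith)+
  next
    case x: zone
    show ?thesis using Suc.prems(2)
    proof (cases rule: part_Suc_cases)
      case zone
      then show ?thesis using x zone_disjoint by blast
    qed (use x in linarith)+
  next
    case x: (high f)
    show ?thesis using Suc.prems(2)
    proof (cases rule: part_Suc_cases)
      case (high g)
      have "g = f" using x(3) high(3) by linarith
      then show ?thesis using x(2) high(2) Suc.IH by blast
    qed (use x in linarith)+
  qed
qed simp

lemma whole_disjoint: "x \<in> whole c \<Longrightarrow> x \<in> whole c' \<Longrightarrow> c = c'"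
proof -
  assume "x \<in> whole c" "x \<in> whole c'"
  moreover have "x < bound (Suc x)" using bound_ge[of "Suc x"] by simp
  ultimately show "c = c'" using in_part_if_less part_disjoint by blast
qed

lemma chosen_subset: "chosen k \<subseteq> part k True \<union> part k False"
  by (auto simp: chosen_def)

lemma chosen_subset_whole: "chosen k \<subseteq> whole True \<union> whole False"
  using chosen_subset part_subset_whole by blast

lemma chosen_less: "f \<in> chosen k \<Longrightarrow> f < bound k"
  using chosen_subset part_less by blast

lemma finite_chosen: "finite (chosen k)"
  using chosen_subset finite_part by (metis finite_Un finite_subset)

lemma special_partner:
  assumes "f \<in> chosen k" "f \<in> whole c"
  shows "special k - f \<in> whole c" "f < special k - f"
proof -
  have f: "f < bound k" "f \<in> part k c" using assms chosen_less in_part_if_less by blast+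
  then have "special k - f \<in> part (Suc k) c" using assms(1) unfolding chosen_def by auto
  then show "special k - f \<in> whole c" using part_subset_whole by blast
  show "f < special k - f" using f bound_le_square[of k] by (simp add: special_def)
qed

text \<open>The larger summand is at least half of \<open>special k\<close>, so it is not old. If it
  were in a zone, the smaller one would be too large to be old and too small to be a partner, hence
  also in a zone, which \<open>zone_sum_neq\<close> excludes. So the larger one is a partner, and
  the smaller one is the \<open>f\<close> it came from.\<close>

lemma special_sum:
  assumes "x \<in> whole c" "y \<in> whole c'" "x \<le> y" "x + y = special k"
  shows "x \<in> chosen k \<and> c = c'"
proof -
  note b = bound_le_square[of k] special_def[of k]
  have "x \<in> part (Suc k) c" "y \<in> part (Suc k) c'"
    using assms by (auto intro!: in_part_if_less simp: bound_Suc simp del: part.simps)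
  from this(2) show ?thesis
  proof (cases rule: part_Suc_cases)
    case y: old
    then show ?thesis using assms b by linarith
  next
    case y: zone
    from \<open>x \<in> part (Suc k) c\<close> show ?thesis
    proof (cases rule: part_Suc_cases)
      case zone
      then show ?thesis using zone_sum_neq y assms special_def by metis
    qed (use y assms b in linarith)+
  next
    case y: (high f)
    have "f = x" using y assms by linarith
    then have "x \<in> chosen k" "x \<in> part k c'" using y by auto
    then show ?thesis using assms(1) part_subset_whole whole_disjoint by blast
  qed
qed

lemma represents_special_iff:
  assumes "D \<subseteq> whole True \<union> whole False"
  shows "represents D (special k) \<longleftrightarrow> (\<exists>f\<in>chosen k. f \<in> D \<and> special k - f \<in> D)"
proof
  assume "represents D (special k)"
  then obtain a a' where a: "a \<in> D" "a' \<in> D" "a \<le> a'" "special k = a + a'"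
    unfolding represents_def by blast
  obtain c c' where "a \<in> whole c" "a' \<in> whole c'" using a assms by blast
  then have "a \<in> chosen k" using special_sum a by metis
  moreover have "a' = special k - a" using a by simp
  ultimately show "\<exists>f\<in>chosen k. f \<in> D \<and> special k - f \<in> D" using a by blast
next
  assume "\<exists>f\<in>chosen k. f \<in> D \<and> special k - f \<in> D"
  then obtain f where f: "f \<in> chosen k" "f \<in> D" "special k - f \<in> D" by blast
  obtain c where "f \<in> whole c" using f assms by blast
  then have "f < special k - f" using special_partner f by blast
  then show "represents D (special k)" unfolding represents_def using f
    by (intro bexI[of _ f] bexI[of _ "special k - f"]) auto
qed

text \<open>The index set \<open>I\<close> lets one statement serve a single colour class and the
  union of both.\<close>

lemma rep_special:
  assumes "A = (\<Union>c\<in>I. whole c)"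
  shows "rep A (special k) = card (chosen k \<inter> A)"
proof -
  have "{(a, a'). a \<in> A \<and> a' \<in> A \<and> a \<le> a' \<and> a + a' = special k}
      = (\<lambda>f. (f, special k - f)) ` (chosen k \<inter> A)" (is "?L = ?R")
  proof (intro equalityI subsetI)
    fix p assume "p \<in> ?L"
    then obtain a a' where p: "p = (a, a')" "a \<in> A" "a' \<in> A" "a \<le> a'" "a + a' = special k" by blast
    then have "a \<in> chosen k" using assms special_sum by (metis UN_E)
    then show "p \<in> ?R" using p by (intro image_eqI[of _ _ a]) auto
  next
    fix p assume "p \<in> ?R"
    then obtain f where f: "p = (f, special k - f)" "f \<in> chosen k" "f \<in> A" by blast
    then obtain c where "c \<in> I" "f \<in> whole c" using assms by blast
    then show "p \<in> ?L" using f special_partner[of f k c] assms by auto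
  qed
  then show ?thesis by (simp add: rep_def card_image inj_on_def)
qed

lemma many_sums:
  assumes "3 * bound k \<le> m" "m < 3 * bound (Suc k)" "m \<notin> range special"
  shows "100 * k \<le> card {x \<in> whole c. x \<le> m \<and> m - x \<in> whole c}"
proof -
  have fin: "finite {x \<in> whole c. x \<le> m \<and> m - x \<in> whole c}"
    by (rule finite_subset[of _ "{..m}"]) auto
  have R: "16 * (100 * k) \<le> bound k" using bound_ge[of k] by simp
  note b = bound_le_square[of k] special_def[of k] bound_Suc[of k]
  show ?thesis
  proof (cases "m \<le> 120 * (bound k)\<^sup>2 + 4 * bound k")
    case True
    have "m \<noteq> 120 * (bound k)\<^sup>2" using assms(3) special_def[of k] by (metis rangeI)
    then have "100 * k \<le> card {x \<in> zone (bound k) c. x \<le> m \<and> m - x \<in> zone (bound k) c}"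
      using zone_sums[OF R b(2) assms(1) True] by blast
    also have "\<dots> \<le> card {x \<in> whole c. x \<le> m \<and> m - x \<in> whole c}"
      by (rule card_mono[OF fin]) (use zone_subset_whole in auto)
    finally show ?thesis .
  next
    case False
    \<comment> \<open>Past the neighbourhood of \<open>special k\<close>, one summand comes from
      this zone and the other from the next.\<close>
    have "100 * k \<le> card {x \<in> zone (bound k) c. x \<le> m \<and> m - x \<in> zone (bound (Suc k)) c}"
      by (rule zone_sums_cross) (use R b False assms in linarith)+
    also have "\<dots> \<le> card {x \<in> whole c. x \<le> m \<and> m - x \<in> whole c}"
      by (rule card_mono[OF fin]) (use zone_subset_whole in blast)
    finally show ?thesis .
  qed
qed

text \<open>Fewer than \<open>50 * k\<close> missing elements cannot spoil all of the
  \<open>100 * k\<close> summands that one colour supplies at level \<open>k\<close>, and these lie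
  below \<open>bound (k + 2)\<close>. The colour may change with \<open>k\<close>.\<close>

lemma asymptotic_basisI:
  assumes "\<forall>\<^sub>F k in sequentially. \<exists>c. card ((whole c - D) \<inter> {..<bound (k + 2)}) < 50 * k"
    and "\<forall>\<^sub>F k in sequentially. represents D (special k)"
  shows "asymptotic_basis D"
  unfolding asymptotic_basis_iff
proof (rule eventually_levelwise[OF _ assms(2)])
  show "\<forall>\<^sub>F k in sequentially. \<forall>m. 3 * bound k \<le> m \<longrightarrow> m < 3 * bound (Suc k) \<longrightarrow>
      m \<notin> range special \<longrightarrow> represents D m"
    using assms(1)
  proof (eventually_elim, intro allI impI)
    fix k m assume "\<exists>c. card ((whole c - D) \<inter> {..<bound (k + 2)}) < 50 * k"
      and m: "3 * bound k \<le> m" "m < 3 * bound (Suc k)" "m \<notin> range special"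
    then obtain c where c: "card ((whole c - D) \<inter> {..<bound (k + 2)}) < 50 * k" by blast
    have "m < bound (k + 2)" using m bound_le_square[of "Suc k"] bound_Suc[of "Suc k"] special_def[of "Suc k"]
      by simp
    then have "card ((whole c - D) \<inter> {..m}) \<le> card ((whole c - D) \<inter> {..<bound (k + 2)})"
      by (intro card_mono) auto
    then show "represents D m"
      using c many_sums[OF m, of c] by (intro represents_if_few_missing[of "whole c"]) linarith
  qed
qed

lemma asymptotic_basis_whole:
  assumes "\<forall>\<^sub>F k in sequentially. chosen k \<inter> whole c \<noteq> {}"
  shows "asymptotic_basis (whole c)"
proof (rule asymptotic_basisI)
  show "\<forall>\<^sub>F k in sequentially. \<exists>c'. card ((whole c' - whole c) \<inter> {..<bound (k + 2)}) < 50 * k"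
    using eventually_gt_at_top[of 0] by eventually_elim (auto intro!: exI[of _ c])
  show "\<forall>\<^sub>F k in sequentially. represents (whole c) (special k)"
    using assms
  proof eventually_elim
    case (elim k)
    have "whole c \<subseteq> whole True \<union> whole False" by (cases c) auto
    then show ?case using elim special_partner represents_special_iff by blast
  qed
qed

lemma rep_tends_to_infinityI:
  assumes A: "A = (\<Union>c\<in>I. whole c)" "I \<noteq> {}"
    and "filterlim (\<lambda>k. card (chosen k \<inter> A)) at_top sequentially"
  shows "rep_tends_to_infinity A"
  unfolding rep_tends_to_infinity_def filterlim_at_top
proof
  fix R
  show "\<forall>\<^sub>F m in sequentially. R \<le> rep A m"
  proof (rule eventually_levelwise)
    show "\<forall>\<^sub>F k in sequentially. R \<le> rep A (special k)"
      using assms(3) rep_special[OF A(1)] unfolding filterlim_at_top by simp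
    obtain c where c: "c \<in> I" using A by blast
    show "\<forall>\<^sub>F k in sequentially. \<forall>m. 3 * bound k \<le> m \<longrightarrow> m < 3 * bound (Suc k) \<longrightarrow>
      m \<notin> range special \<longrightarrow> R \<le> rep A m"
      using eventually_ge_at_top[of R]
    proof (eventually_elim, intro allI impI)
      fix k m assume k: "R \<le> k"
        and m: "3 * bound k \<le> m" "m < 3 * bound (Suc k)" "m \<notin> range special"
      have "card {x \<in> whole c. x \<le> m \<and> m - x \<in> whole c} \<le> card {x \<in> A. x \<le> m \<and> m - x \<in> A}"
      proof (rule card_mono)
        show "finite {x \<in> A. x \<le> m \<and> m - x \<in> A}" by (rule finite_subset[of _ "{..m}"]) auto
      qed (use A c in auto)
      then show "R \<le> rep A m" using many_sums[OF m, of c] k card_summands_le_rep[of A m] by linarith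
    qed
  qed
qed

lemma not_rep_tends_to_infinityI:
  assumes A: "A = (\<Union>c\<in>I. whole c)"
    and "\<exists>\<^sub>F k in sequentially. card (chosen k \<inter> A) \<le> R"
  shows "\<not> rep_tends_to_infinity A"
proof
  assume "rep_tends_to_infinity A"
  then have "\<forall>\<^sub>F m in sequentially. Suc R \<le> rep A m"
    unfolding rep_tends_to_infinity_def filterlim_at_top by blast
  then obtain M where M: "\<And>m. M \<le> m \<Longrightarrow> Suc R \<le> rep A m" unfolding eventually_sequentially by blast
  have "\<forall>\<^sub>F k in sequentially. M \<le> k" by (rule eventually_ge_at_top)
  then have "\<forall>\<^sub>F k in sequentially. \<not> card (chosen k \<inter> A) \<le> R"
  proof eventually_elim
    case (elim k)
    then have "Suc R \<le> rep A (special k)" using M special_ge[of k] by simp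
    then show ?case using rep_special[OF A] by simp
  qed
  then show False using assms(2) unfolding frequently_def by blast
qed

text \<open>The representations of the single number \<open>3 * bound k\<close> already use that
  many different elements of the zone.\<close>

lemma card_part_ge: "100 * k \<le> card (part (Suc k) c \<inter> {bound k..})"
proof -
  have "100 * k \<le> card {x \<in> zone (bound k) c. x \<le> 3 * bound k \<and> 3 * bound k - x \<in> zone (bound k) c}"
    by (rule zone_sums) (use bound_ge[of k] bound_le_square[of k] in auto)
  also have "\<dots> \<le> card (part (Suc k) c \<inter> {bound k..})"
    by (rule card_mono) (use finite_part[of "Suc k" c] zone_bounds zone_subset_part in auto)
  finally show ?thesis .
qed

text \<open>Without \<open>m\<close>, infinitely many special numbers lose their only representation
  within the class.\<close>

lemma minimal_whole:
  assumes "\<forall>\<^sub>F k in sequentially. chosen k \<inter> whole c \<noteq> {}"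
    and "\<And>m. m \<in> whole c \<Longrightarrow> \<exists>\<^sub>F k in sequentially. chosen k \<inter> whole c = {m}"
  shows "minimal_asymptotic_basis (whole c)"
  unfolding minimal_asymptotic_basis_def
proof (intro conjI allI impI)
  show "asymptotic_basis (whole c)" by (rule asymptotic_basis_whole[OF assms(1)])
  fix B assume "B \<subset> whole c"
  then have B: "B \<subseteq> whole c" by (rule psubset_imp_subset)
  obtain m where m: "m \<in> whole c" "m \<notin> B" using psubset_imp_ex_mem[OF \<open>B \<subset> whole c\<close>] by blast
  show "\<not> asymptotic_basis B"
  proof
    assume "asymptotic_basis B"
    then obtain M where M: "\<And>n. M \<le> n \<Longrightarrow> represents B n"
      unfolding asymptotic_basis_iff eventually_sequentially by blast
    obtain k where k: "M \<le> k" "chosen k \<inter> whole c = {m}"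
      using assms(2)[OF m(1)] unfolding frequently_sequentially by blast
    have "represents B (special k)" using M special_ge[of k] k by simp
    moreover have "B \<subseteq> whole True \<union> whole False" using B by (cases c) auto
    ultimately obtain f where "f \<in> chosen k" "f \<in> B" using represents_special_iff by blast
    then have "f = m" using k(2) B by auto
    then show False using \<open>f \<in> B\<close> m by simp
  qed
qed

end

context construction
begin

lemma card_part_from: "2 \<le> k \<Longrightarrow> 2 * k \<le> card (part k c \<inter> {k..})"
proof -
  assume k: "2 \<le> k"
  then obtain j where j: "k = Suc j" "1 \<le> j" by (cases k) auto
  have "2 * k \<le> 100 * j" using j by simp
  also have "\<dots> \<le> card (part k c \<inter> {bound j..})" using card_part_ge[of j c] j by simp
  also have "\<dots> \<le> card (part k c \<inter> {k..})"
  proof (rule card_mono)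
    have "k \<le> bound j" using bound_ge[of j] j by simp
    then show "part k c \<inter> {bound j..} \<subseteq> part k c \<inter> {k..}" by auto
  qed (use finite_part in blast)
  finally show ?thesis .
qed

lemma Max_part:
  assumes "2 \<le> k"
  shows "Max (part k c) \<in> part k c" "k \<le> Max (part k c)"
proof -
  have "part k c \<inter> {k..} \<noteq> {}" using card_part_from[OF assms, of c] assms by auto
  then obtain x where x: "x \<in> part k c" "k \<le> x" by blast
  then show "Max (part k c) \<in> part k c" using finite_part Max_in by blast
  show "k \<le> Max (part k c)" using x finite_part Max_ge by (meson order_trans)
qed

text \<open>The factor 2 serves the splitting arguments: two subsets that each miss fewer than
  \<open>i\<close> elements of this window cannot be disjoint.\<close>

lemma card_whole_level: "2 \<le> i \<Longrightarrow> 2 * i \<le> card (whole c \<inter> {i..<bound i})"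
proof -
  assume "2 \<le> i"
  moreover have "whole c \<inter> {i..<bound i} = part i c \<inter> {i..}"
    unfolding whole_below[of c i, symmetric] by auto
  ultimately show ?thesis using card_part_from[of i c] by (simp only:)
qed

lemma represents_special_if_basis:
  assumes "asymptotic_basis D"
  shows "\<forall>\<^sub>F k in sequentially. represents D (special k)"
proof -
  obtain M where "\<And>n. M \<le> n \<Longrightarrow> represents D n"
    using assms unfolding asymptotic_basis_iff eventually_sequentially by blast
  then show ?thesis
    unfolding eventually_sequentially using special_ge by (meson order_trans)
qed

lemma chosen_meets_basis:
  assumes "asymptotic_basis D" "D \<subseteq> whole True \<union> whole False"
  shows "\<forall>\<^sub>F k in sequentially. chosen k \<inter> D \<noteq> {}"
  using represents_special_if_basis[OF assms(1)]
  by eventually_elim (use represents_special_iff[OF assms(2)] in blast)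

end

lemma basis_nonempty: "asymptotic_basis D \<Longrightarrow> D \<noteq> {}"
  unfolding asymptotic_basis_def by (metis empty_iff lessI)

section \<open>Coding of finite sets and levels by natural numbers\<close>

definition code_set :: "nat \<Rightarrow> nat set" where
  "code_set k = set_decode (fst (prod_decode k))"

definition code_level :: "nat \<Rightarrow> nat" where
  "code_level k = snd (prod_decode k)"

text \<open>By \<open>i \<le> k\<close>, all elements of the final set below \<open>bound i\<close>
  are present at stage \<open>k\<close>, so a coded set of such elements can be chosen
  there.\<close>

lemma code_exists:
  assumes "finite F"
  obtains k where "code_set k = F" "code_level k = i" "i \<le> k"
  using that[of "prod_encode (set_encode F, i)"] assms le_prod_encode_2
  by (simp add: code_set_def code_level_def)

text \<open>Only finitely many sets lie below the \<open>bound\<close> of a given level, and each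
  pair of a set and a level has a single code.\<close>

lemma code_level_unbounded:
  "\<forall>\<^sub>F k in sequentially. code_set k \<subseteq> {..<bound (code_level k)} \<longrightarrow> b \<le> code_level k"
proof -
  have "{k. \<not> (code_set k \<subseteq> {..<bound (code_level k)} \<longrightarrow> b \<le> code_level k)}
      \<subseteq> prod_encode ` (set_encode ` Pow {..<bound b} \<times> {..<b})"
  proof
    fix k assume "k \<in> {k. \<not> (code_set k \<subseteq> {..<bound (code_level k)} \<longrightarrow> b \<le> code_level k)}"
    then have k: "code_set k \<subseteq> {..<bound (code_level k)}" "code_level k < b" by auto
    then have "code_set k \<in> Pow {..<bound b}" using bound_mono[of "code_level k" b] by fastforce
    moreover have "k = prod_encode (set_encode (code_set k), code_level k)"
      by (simp add: code_set_def code_level_def)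
    ultimately show "k \<in> prod_encode ` (set_encode ` Pow {..<bound b} \<times> {..<b})"
      using k(2) by (metis (no_types, lifting) SigmaI image_eqI lessThan_iff)
  qed
  then have "finite {k. \<not> (code_set k \<subseteq> {..<bound (code_level k)} \<longrightarrow> b \<le> code_level k)}"
    by (rule finite_subset) auto
  then show ?thesis
    by (simp add: cofinite_eq_sequentially[symmetric] eventually_cofinite)
qed

section \<open>Bases without minimal sub-bases\<close>

definition balanced :: "nat \<Rightarrow> (bool \<Rightarrow> nat set) \<Rightarrow> bool" where
  "balanced k V \<longleftrightarrow> 0 < code_level k \<and> code_set k \<subseteq> {code_level k..<bound (code_level k)} \<and>
     code_set k \<subseteq> V True \<union> V False \<and> (\<forall>c. code_level k \<le> card (code_set k \<inter> V c))"

text \<open>The default decides (P1): \<open>{k..}\<close> gives a growing number of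
  representations, the two maxima at most two. Either default meets both colours and avoids small
  numbers.\<close>

definition balanced_choice :: "bool \<Rightarrow> nat \<Rightarrow> (bool \<Rightarrow> nat set) \<Rightarrow> nat set" where
  "balanced_choice p k V = (if balanced k V then code_set k
     else if p then {k..} else {Max (V True), Max (V False)})"

context
  fixes p :: bool
begin

interpretation construction "balanced_choice p" .

lemma chosen_balanced: "balanced k (part k) \<Longrightarrow> chosen k = code_set k"
  by (auto simp: chosen_def balanced_choice_def balanced_def)

lemma chosen_not_balanced:
  assumes "\<not> balanced k (part k)" "2 \<le> k"
  shows "chosen k = (if p then (part k True \<union> part k False) \<inter> {k..}
    else {Max (part k True), Max (part k False)})"
  using assms Max_part[of k True] Max_part[of k False] by (auto simp: chosen_def balanced_choice_def)

lemma balanced_level: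
  "\<forall>\<^sub>F k in sequentially. balanced k (part k) \<longrightarrow> b \<le> code_level k"
  using code_level_unbounded[of b] by eventually_elim (auto simp: balanced_def)

text \<open>Default choices lie at or above \<open>k\<close>, and coded sets at or above their
  level, which exceeds any \<open>b\<close> for all large balanced \<open>k\<close>.\<close>

lemma balanced_chosen_large: "\<forall>\<^sub>F k in sequentially. \<forall>f\<in>chosen k. b \<le> f"
  using balanced_level[of b] eventually_ge_at_top[of 2] eventually_ge_at_top[of b]
proof eventually_elim
  case (elim k)
  show ?case
  proof (cases "balanced k (part k)")
    case True
    then show ?thesis using elim(1) chosen_balanced[OF True] unfolding balanced_def by fastforce
  next
    case False
    then show ?thesis
      using elim chosen_not_balanced[OF False elim(2)] Max_part[OF elim(2), of True] Max_part[OF elim(2), of False]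
      by auto
  qed
qed

lemma balanced_chosen_colour: 
  "\<forall>\<^sub>F k in sequentially. (if p then b else 1) \<le> card (chosen k \<inter> whole c)"
  using balanced_level[of "max 1 b"] eventually_ge_at_top[of 2] eventually_ge_at_top[of b]
proof eventually_elim
  case (elim k)
  have fin: "finite (chosen k \<inter> whole c)" using finite_chosen by blast
  show ?case
  proof (cases "balanced k (part k)")
    case True
    have "max 1 b \<le> code_level k" using elim True by blast
    also have "\<dots> \<le> card (code_set k \<inter> part k c)" using True unfolding balanced_def by blast
    also have "\<dots> \<le> card (chosen k \<inter> whole c)"
      using chosen_balanced[OF True] part_subset_whole by (intro card_mono fin) blast
    finally show ?thesis by auto
  next
    case False
    show ?thesis
    proof (cases p)
      case True
      have "b \<le> card (part k c \<inter> {k..})" using card_part_from[OF elim(2), of c] elim by linarith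
      also have "\<dots> \<le> card (chosen k \<inter> whole c)"
      proof (rule card_mono[OF fin])
        have "part k c \<subseteq> part k True \<union> part k False" by (cases c) auto
        then show "part k c \<inter> {k..} \<subseteq> chosen k \<inter> whole c"
          using chosen_not_balanced[OF False elim(2)] True part_subset_whole[of k c] by auto
      qed
      finally show ?thesis using True by simp
    next
      case np: False
      have "Max (part k c) \<in> chosen k"
        using chosen_not_balanced[OF False elim(2)] np by (cases c) auto
      then have "Max (part k c) \<in> chosen k \<inter> whole c"
        using Max_part(1)[OF elim(2), of c] part_subset_whole by blast
      then show ?thesis using fin np by (metis One_nat_def Suc_leI card_gt_0_iff empty_iff)
    qed
  qed
qed

lemma balanced_whole_basis: "asymptotic_basis (whole c)"
proof (rule asymptotic_basis_whole)
  show "\<forall>\<^sub>F k in sequentially. chosen k \<inter> whole c \<noteq> {}"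
    using balanced_chosen_colour[of 1 c] by eventually_elim (auto split: if_splits)
qed

lemma balanced_rep_iff:
  assumes A: "A = (\<Union>c\<in>I. whole c)" "I \<noteq> {}"
  shows "rep_tends_to_infinity A \<longleftrightarrow> p"
proof (cases p)
  case True
  have "filterlim (\<lambda>k. card (chosen k \<inter> A)) at_top sequentially"
    unfolding filterlim_at_top
  proof
    fix b
    obtain c where c: "c \<in> I" using A by blast
    show "\<forall>\<^sub>F k in sequentially. b \<le> card (chosen k \<inter> A)"
      using balanced_chosen_colour[of b c]
    proof eventually_elim
      case (elim k)
      have "card (chosen k \<inter> whole c) \<le> card (chosen k \<inter> A)"
        using finite_chosen A c by (intro card_mono) auto
      then show ?case using elim True by simp
    qed
  qed
  then show ?thesis using rep_tends_to_infinityI[OF A] True by blast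
next
  case False
  have "\<exists>\<^sub>F k in sequentially. card (chosen k \<inter> A) \<le> 2"
    unfolding frequently_sequentially
  proof
    fix n
    \<comment> \<open>The empty set with a positive level is never balanced, so the default occurs
      at arbitrarily late stages.\<close>
    obtain k where k: "code_set k = {}" "code_level k = Suc (Suc n)" "Suc (Suc n) \<le> k"
      using code_exists[of "{}"] by blast
    have "\<not> balanced k (part k)" using k by (simp add: balanced_def)
    moreover have k2: "2 \<le> k" using k by simp
    ultimately have "chosen k = {Max (part k True), Max (part k False)}"
      using chosen_not_balanced[of k] False by simp
    then have "card (chosen k) \<le> 2" by (simp add: card_insert_if)
    moreover have "card (chosen k \<inter> A) \<le> card (chosen k)" by (intro card_mono finite_chosen) simp
    ultimately show "\<exists>k\<ge>n. card (chosen k \<inter> A) \<le> 2" using k(3) by (intro exI[of _ k]) simp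
  qed
  then show ?thesis using not_rep_tends_to_infinityI[OF A(1)] False by blast
qed

text \<open>Otherwise the elements missing from \<open>D\<close> between \<open>i\<close> and
  \<open>bound i\<close>, at least \<open>i\<close> of either colour, form a balanced set. Some
  stage \<open>k \<ge> i\<close> chooses exactly this set, and \<open>special k\<close> is not
  represented by \<open>D\<close>.\<close>

lemma balanced_basis_thick:
  assumes D: "asymptotic_basis D" "D \<subseteq> whole True \<union> whole False"
  shows "\<forall>\<^sub>F i in sequentially. \<exists>c. card ((whole c - D) \<inter> {i..<bound i}) < i"
proof -
  obtain K where K: "\<And>k. K \<le> k \<Longrightarrow> chosen k \<inter> D \<noteq> {}"
    using chosen_meets_basis[OF D] unfolding eventually_sequentially by blast
  show ?thesis using eventually_ge_at_top[of K] eventually_gt_at_top[of 0]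
  proof eventually_elim
    case (elim i)
    show ?case
    proof (rule ccontr)
      assume "\<not> ?case"
      then have many: "i \<le> card ((whole c - D) \<inter> {i..<bound i})" for c by (meson not_less)
      define F where "F = (whole True \<union> whole False - D) \<inter> {i..<bound i}"
      obtain k where k: "code_set k = F" "code_level k = i" "i \<le> k"
        using code_exists[of F] by (auto simp: F_def)
      have sub: "(whole c - D) \<inter> {i..<bound i} \<subseteq> F \<inter> part k c" for c
      proof
        fix x assume x: "x \<in> (whole c - D) \<inter> {i..<bound i}"
        then have "x < bound k" using bound_mono[OF k(3)] by auto
        then have "x \<in> part k c" using x in_part_if_less by blast
        then show "x \<in> F \<inter> part k c" using x by (cases c) (auto simp: F_def)
      qed
      have "F \<subseteq> part k True \<union> part k False" using sub[of True] sub[of False] by (auto simp: F_def)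
      moreover have "i \<le> card (F \<inter> part k c)" for c
        using many[of c] card_mono[OF _ sub[of c]] finite_part by (meson finite_Int order_trans)
      ultimately have "balanced k (part k)"
        using k elim by (auto simp: balanced_def F_def)
      then have "chosen k \<inter> D = {}" using chosen_balanced k by (auto simp: F_def)
      then show False using K k elim by (metis order_trans)
    qed
  qed
qed

text \<open>By thickness some colour class supplies every large non-special number even after removing \<open>b\<close>,
  and \<open>b\<close> is a summand of only finitely many special numbers.\<close>

lemma balanced_no_minimal:
  assumes "A \<subseteq> whole True \<union> whole False"
  shows "\<not> contains_minimal_basis A"
proof
  assume "contains_minimal_basis A"
  then obtain D where min: "minimal_asymptotic_basis D" and "D \<subseteq> A"
    unfolding contains_minimal_basis_def by blast
  have sub: "D \<subseteq> whole True \<union> whole False" using \<open>D \<subseteq> A\<close> assms by (rule order_trans)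
  have D: "asymptotic_basis D" "\<And>B. B \<subset> D \<Longrightarrow> \<not> asymptotic_basis B"
    using min unfolding minimal_asymptotic_basis_def by simp_all
  obtain b where b: "b \<in> D" using basis_nonempty[OF D(1)] by blast
  have "asymptotic_basis (D - {b})"
  proof (rule asymptotic_basisI)
    \<comment> \<open>Thickness is shifted by 2 to reach up to \<open>bound (k + 2)\<close>, as
      \<open>asymptotic_basisI\<close> demands.\<close>
    have "\<forall>\<^sub>F k in sequentially. \<exists>c. card ((whole c - D) \<inter> {k + 2..<bound (k + 2)}) < k + 2"
      using balanced_basis_thick[OF D(1) sub] by (subst eventually_sequentially_seg)
    then show "\<forall>\<^sub>F k in sequentially. \<exists>c. card ((whole c - (D - {b})) \<inter> {..<bound (k + 2)}) < 50 * k"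
      using eventually_gt_at_top[of 0]
    proof eventually_elim
      case (elim k)
      then obtain c where c: "card ((whole c - D) \<inter> {k + 2..<bound (k + 2)}) < k + 2" by blast
      let ?M = "(whole c - D) \<inter> {k + 2..<bound (k + 2)}"
      \<comment> \<open>Nothing is known below \<open>k + 2\<close>, so all of these numbers are
        counted as missing; in total at most \<open>2 * k + 4\<close> elements.\<close>
      have "card ((whole c - (D - {b})) \<inter> {..<bound (k + 2)}) \<le> card (insert b ({..<k + 2} \<union> ?M))"
        by (rule card_mono) auto
      also have "\<dots> \<le> Suc (card ({..<k + 2} \<union> ?M))" by (rule card_insert_le_m1) auto
      also have "\<dots> \<le> Suc (card {..<k + 2} + card ?M)"
        by (intro Suc_le_mono[THEN iffD2] card_Un_le)
      also have "\<dots> < 50 * k" using c elim by simp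
      finally show ?case by blast
    qed
    show "\<forall>\<^sub>F k in sequentially. represents (D - {b}) (special k)"
      using represents_special_if_basis[OF D(1)] balanced_chosen_large[of "Suc b"]
    proof eventually_elim
      case (elim k)
      obtain f where f: "f \<in> chosen k" "f \<in> D" "special k - f \<in> D"
        using elim(1) represents_special_iff[OF sub, of k] by blast
      \<comment> \<open>The smaller summand already exceeds \<open>b\<close>, so neither summand is
        \<open>b\<close>.\<close>
      have "b < f" using elim(2) f(1) by fastforce
      obtain c where "f \<in> whole c" using f(2) sub by blast
      then have "f < special k - f" using f(1) special_partner(2) by blast
      with \<open>b < f\<close> have "f \<in> D - {b}" "special k - f \<in> D - {b}" using f by auto
      moreover have "D - {b} \<subseteq> whole True \<union> whole False" using sub by blast
      ultimately show ?case using f(1) represents_special_iff[of "D - {b}" k] by blast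
    qed
  qed
  then show False using D(2)[of "D - {b}"] b by blast
qed

lemma balanced_union_splits: "splits_into_two_bases (whole True \<union> whole False)"
  unfolding splits_into_two_bases_def
  using balanced_whole_basis whole_disjoint by (metis disjoint_iff)

text \<open>A basis inside the class of \<open>True\<close> misses the whole other class, so the
  colour provided by thickness is \<open>True\<close>. Two disjoint bases would leave the window
  \<open>{i..<bound i}\<close> with fewer than \<open>2 * i\<close> elements of the class.\<close>

lemma balanced_whole_not_splits: "\<not> splits_into_two_bases (whole True)"
proof
  assume "splits_into_two_bases (whole True)"
  then obtain B C where BC: "whole True = B \<union> C" "B \<inter> C = {}" "asymptotic_basis B" "asymptotic_basis C"
    unfolding splits_into_two_bases_def by blast
  have few: "\<forall>\<^sub>F i in sequentially. card ((whole True - D) \<inter> {i..<bound i}) < i"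
    if D: "asymptotic_basis D" "D \<subseteq> whole True" for D
  proof -
    have "\<forall>\<^sub>F i in sequentially. \<exists>c. card ((whole c - D) \<inter> {i..<bound i}) < i"
      using D by (intro balanced_basis_thick) auto
    then show ?thesis using eventually_ge_at_top[of 2]
    proof eventually_elim
      case (elim i)
      then obtain c where c: "card ((whole c - D) \<inter> {i..<bound i}) < i" by blast
      have "whole False - D = whole False" using D whole_disjoint by blast
      then show ?case using c card_whole_level[OF elim(2), of False] by (cases c) simp_all
    qed
  qed
  have "B \<subseteq> whole True" "C \<subseteq> whole True" using BC(1) by auto
  note few = few[OF BC(3) this(1)] few[OF BC(4) this(2)]
  have "\<forall>\<^sub>F i in sequentially. False"
    using few eventually_ge_at_top[of 2]
  proof eventually_elim
    case (elim i)
    have "whole True \<inter> {i..<bound i} \<subseteq>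
        (whole True - B) \<inter> {i..<bound i} \<union> (whole True - C) \<inter> {i..<bound i}"
      using BC(2) by blast
    then have "card (whole True \<inter> {i..<bound i}) \<le>
        card ((whole True - B) \<inter> {i..<bound i} \<union> (whole True - C) \<inter> {i..<bound i})"
      by (intro card_mono) auto
    also have "\<dots> \<le> card ((whole True - B) \<inter> {i..<bound i}) + card ((whole True - C) \<inter> {i..<bound i})"
      by (rule card_Un_le)
    finally show False using elim card_whole_level[of i True] by simp
  qed
  then show False by simp
qed

lemma balanced_split_example:
  "\<exists>A. asymptotic_basis A \<and> (rep_tends_to_infinity A \<longleftrightarrow> p) \<and>
    splits_into_two_bases A \<and> \<not> contains_minimal_basis A"
proof (intro exI conjI)
  let ?A = "whole True \<union> whole False"
  show "asymptotic_basis ?A" by (rule asymptotic_basis_mono[OF balanced_whole_basis[of True]]) simp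
  have "?A = (\<Union>c\<in>UNIV. whole c)" by (simp add: UNIV_bool Un_commute)
  then show "rep_tends_to_infinity ?A \<longleftrightarrow> p" by (rule balanced_rep_iff) simp
qed (use balanced_union_splits balanced_no_minimal in auto)

lemma balanced_nonsplit_example:
  "\<exists>A. asymptotic_basis A \<and> (rep_tends_to_infinity A \<longleftrightarrow> p) \<and>
    \<not> splits_into_two_bases A \<and> \<not> contains_minimal_basis A"
proof (intro exI conjI)
  show "rep_tends_to_infinity (whole True) \<longleftrightarrow> p" by (rule balanced_rep_iff[of _ "{True}"]) auto
qed (use balanced_whole_basis balanced_whole_not_splits balanced_no_minimal in auto)

end

section \<open>Bases with minimal sub-bases\<close>

text \<open>With \<open>p\<close>, the one-sided chosen sets force every basis to contain almost all of the minimal class, which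
  rules out a splitting, and the second colour class only serves to raise the representation function.\<close>

definition one_sided :: "nat \<Rightarrow> (bool \<Rightarrow> nat set) \<Rightarrow> bool" where
  "one_sided k V \<longleftrightarrow> 0 < code_level k \<and> code_set k \<subseteq> {..<bound (code_level k)} \<and>
     code_set k \<subseteq> V True \<and> code_level k \<le> card (code_set k)"

text \<open>The level is decoded once more as a pair, of which only the first component is read;
  thus every \<open>m\<close> is named by infinitely many levels. \<open>Max M\<close> is a default
  for an \<open>m\<close> not yet built.\<close>

definition critical_summand :: "nat \<Rightarrow> nat set \<Rightarrow> nat" where
  "critical_summand k M = (let m = fst (prod_decode (code_level k)) in if m \<in> M then m else Max M)"

text \<open>Outside the one-sided stages exactly one summand has colour \<open>True\<close>. The
  other colour then contributes all of its elements if (P1) is wanted, and otherwise a single one,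
  enough to make its class a basis as well.\<close>

definition critical_choice :: "bool \<Rightarrow> nat \<Rightarrow> (bool \<Rightarrow> nat set) \<Rightarrow> nat set" where
  "critical_choice p k V = (if p \<and> one_sided k V then code_set k
     else insert (critical_summand k (V True)) (if p then V False else {Max (V False)}))"

context
  fixes p :: bool
begin

interpretation construction "critical_choice p" .

lemma critical_summand_in: "2 \<le> k \<Longrightarrow> critical_summand k (part k True) \<in> part k True"
  using Max_part(1)[of k True] by (simp add: critical_summand_def Let_def)

lemma chosen_one_sided: "p \<Longrightarrow> one_sided k (part k) \<Longrightarrow> chosen k = code_set k"
  unfolding chosen_def critical_choice_def[of p] one_sided_def by auto

lemma chosen_critical:
  assumes "\<not> (p \<and> one_sided k (part k))" "2 \<le> k"
  shows "chosen k = insert (critical_summand k (part k True)) (if p then part k False else {Max (part k False)})"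
  using assms critical_summand_in Max_part(1)[of k False] by (auto simp: chosen_def critical_choice_def)

lemma chosen_critical_True:
  assumes "\<not> (p \<and> one_sided k (part k))" "2 \<le> k"
  shows "chosen k \<inter> whole True = {critical_summand k (part k True)}"
proof -
  have "(if p then part k False else {Max (part k False)}) \<subseteq> whole False"
    using Max_part(1)[OF assms(2), of False] part_subset_whole[of k False] by auto
  moreover have "whole True \<inter> whole False = {}" using whole_disjoint by blast
  moreover have "critical_summand k (part k True) \<in> whole True"
    using critical_summand_in[OF assms(2)] part_subset_whole by blast
  ultimately show ?thesis using chosen_critical[OF assms] by blast
qed

lemma critical_minimal: "minimal_asymptotic_basis (whole True)"
proof (rule minimal_whole)
  show "\<forall>\<^sub>F k in sequentially. chosen k \<inter> whole True \<noteq> {}"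
    using eventually_ge_at_top[of 2]
  proof eventually_elim
    case (elim k)
    show ?case
    proof (cases "p \<and> one_sided k (part k)")
      case True
      then have "chosen k = code_set k" using chosen_one_sided by blast
      moreover have "0 < card (code_set k)" using True unfolding one_sided_def by linarith
      then have "code_set k \<noteq> {}" by auto
      moreover have "code_set k \<subseteq> whole True"
        using True part_subset_whole[of k True] unfolding one_sided_def by blast
      ultimately show ?thesis by blast
    next
      case False
      then show ?thesis using chosen_critical_True[OF False elim] by simp
    qed
  qed
  fix m assume m: "m \<in> whole True"
  show "\<exists>\<^sub>F k in sequentially. chosen k \<inter> whole True = {m}"
    unfolding frequently_sequentially
  proof
    fix n
    \<comment> \<open>The padding \<open>n + m + 2\<close> forces \<open>k \<ge> n\<close>,
      \<open>k \<ge> 2\<close> and \<open>m < bound k\<close>, so \<open>m\<close> is already built.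
      The empty set coded along with it prevents a one-sided stage.\<close>
    define i where "i = prod_encode (m, n + m + 2)"
    have i: "n + m + 2 \<le> i" unfolding i_def by (rule le_prod_encode_2)
    obtain k where k: "code_set k = {}" "code_level k = i" "i \<le> k"
      using code_exists[of "{}"] by blast
    have "m < bound k" using bound_ge[of k] k i by linarith
    then have "m \<in> part k True" using m in_part_if_less by blast
    then have "critical_summand k (part k True) = m"
      using k(2) by (simp add: critical_summand_def i_def)
    moreover have "\<not> one_sided k (part k)" using k i by (simp add: one_sided_def)
    ultimately have "chosen k \<inter> whole True = {m}" using chosen_critical_True[of k] k i by simp
    then show "\<exists>k\<ge>n. chosen k \<inter> whole True = {m}" using k i by (intro exI[of _ k]) simp
  qed
qed

lemma critical_union_contains_minimal: "contains_minimal_basis (whole True \<union> whole False)"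
  unfolding contains_minimal_basis_def using critical_minimal by blast

lemma critical_union_basis: "asymptotic_basis (whole True \<union> whole False)"
  using critical_minimal asymptotic_basis_mono[of "whole True" "whole True \<union> whole False"]
  by (simp add: minimal_asymptotic_basis_def)

lemma critical_union: "whole True \<union> whole False = (\<Union>c\<in>UNIV. whole c)"
  by (simp add: UNIV_bool Un_commute)

text \<open>One-sided stages choose at least as many elements as their level, which grows; all other
  late stages choose the whole of \<open>part k False\<close>.\<close>

lemma critical_rep:
  assumes p
  shows "rep_tends_to_infinity (whole True \<union> whole False)"
proof (rule rep_tends_to_infinityI[OF critical_union])
  show "filterlim (\<lambda>k. card (chosen k \<inter> (whole True \<union> whole False))) at_top sequentially"
    unfolding filterlim_at_top
  proof
    fix b
    show "\<forall>\<^sub>F k in sequentially. b \<le> card (chosen k \<inter> (whole True \<union> whole False))"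
      using code_level_unbounded[of b] eventually_ge_at_top[of 2] eventually_ge_at_top[of b]
    proof eventually_elim
      case (elim k)
      have *: "chosen k \<inter> (whole True \<union> whole False) = chosen k" using chosen_subset_whole by blast
      show ?case
      proof (cases "one_sided k (part k)")
        case True
        then have "b \<le> code_level k" "code_level k \<le> card (code_set k)"
          using elim(1) unfolding one_sided_def by blast+
        then show ?thesis using chosen_one_sided[OF assms True] * by simp
      next
        case False
        have "b \<le> card (part k False \<inter> {k..})" using card_part_from[OF elim(2), of False] elim by linarith
        also have "\<dots> \<le> card (chosen k)"
        proof (rule card_mono[OF finite_chosen])
          have "part k False \<subseteq> chosen k"
            using chosen_critical[OF _ elim(2)] False assms by (metis subset_insertI)
          then show "part k False \<inter> {k..} \<subseteq> chosen k" by blast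
        qed
        finally show ?thesis using * by simp
      qed
    qed
  qed
qed simp

text \<open>If a basis \<open>D\<close> missed \<open>i\<close> elements of
  \<open>whole True\<close> in \<open>{i..<bound i}\<close> for a large \<open>i\<close>, some stage
  would choose precisely the missing ones and \<open>D\<close> would not represent its special
  number. Two disjoint bases would thus leave fewer than \<open>2 * i\<close> elements of
  \<open>whole True\<close> in the window.\<close>

lemma critical_union_not_splits:
  assumes p
  shows "\<not> splits_into_two_bases (whole True \<union> whole False)"
proof
  assume "splits_into_two_bases (whole True \<union> whole False)"
  then obtain B C where BC: "whole True \<union> whole False = B \<union> C" "B \<inter> C = {}"
      "asymptotic_basis B" "asymptotic_basis C"
    unfolding splits_into_two_bases_def by blast
  have few: "\<forall>\<^sub>F i in sequentially. card ((whole True - D) \<inter> {i..<bound i}) < i"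
    if D: "asymptotic_basis D" "D \<subseteq> whole True \<union> whole False" for D
  proof -
    obtain K where K: "\<And>k. K \<le> k \<Longrightarrow> chosen k \<inter> D \<noteq> {}"
      using chosen_meets_basis[OF D] unfolding eventually_sequentially by blast
    show ?thesis using eventually_ge_at_top[of K] eventually_gt_at_top[of 0]
    proof eventually_elim
      case (elim i)
      show ?case
      proof (rule ccontr)
        assume many: "\<not> ?case"
        define F where "F = (whole True - D) \<inter> {i..<bound i}"
        obtain k where k: "code_set k = F" "code_level k = i" "i \<le> k"
          using code_exists[of F] by (auto simp: F_def)
        have "F \<subseteq> part k True"
        proof
          fix x assume x: "x \<in> F"
          then have "x < bound k" using bound_mono[OF k(3)] by (auto simp: F_def)
          then show "x \<in> part k True" using x in_part_if_less by (auto simp: F_def)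
        qed
        then have "one_sided k (part k)"
          using k elim many by (auto simp: one_sided_def F_def)
        then have "chosen k \<inter> D = {}" using chosen_one_sided[OF assms] k by (auto simp: F_def)
        then show False using K k elim by (metis order_trans)
      qed
    qed
  qed
  have "B \<subseteq> whole True \<union> whole False" "C \<subseteq> whole True \<union> whole False" using BC by auto
  note few = few[OF BC(3) this(1)] few[OF BC(4) this(2)]
  have "\<forall>\<^sub>F i in sequentially. False"
    using few eventually_ge_at_top[of 2]
  proof eventually_elim
    case (elim i)
    have "whole True \<inter> {i..<bound i} \<subseteq>
        (whole True - B) \<inter> {i..<bound i} \<union> (whole True - C) \<inter> {i..<bound i}"
      using BC(2) by blast
    then have "card (whole True \<inter> {i..<bound i}) \<le>
        card ((whole True - B) \<inter> {i..<bound i} \<union> (whole True - C) \<inter> {i..<bound i})"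
      by (intro card_mono) auto
    also have "\<dots> \<le> card ((whole True - B) \<inter> {i..<bound i}) + card ((whole True - C) \<inter> {i..<bound i})"
      by (rule card_Un_le)
    finally show False using elim card_whole_level[of i True] by simp
  qed
  then show False by simp
qed

lemma critical_frequently:
  "\<exists>\<^sub>F k in sequentially. 2 \<le> k \<and> \<not> one_sided k (part k)"
  unfolding frequently_sequentially
proof
  fix n
  obtain k where k: "code_set k = {}" "code_level k = Suc (Suc n)" "Suc (Suc n) \<le> k"
    using code_exists[of "{}"] by blast
  then show "\<exists>k\<ge>n. 2 \<le> k \<and> \<not> one_sided k (part k)"
    by (intro exI[of _ k]) (simp add: one_sided_def)
qed

lemma critical_whole_not_rep: "\<not> rep_tends_to_infinity (whole True)"
proof (rule not_rep_tends_to_infinityI[of _ "{True}" 1])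
  show "\<exists>\<^sub>F k in sequentially. card (chosen k \<inter> whole True) \<le> 1"
    using critical_frequently by (rule frequently_elim1) (simp add: chosen_critical_True)
qed simp

lemma critical_union_not_rep:
  assumes "\<not> p"
  shows "\<not> rep_tends_to_infinity (whole True \<union> whole False)"
proof (rule not_rep_tends_to_infinityI[OF critical_union])
  show "\<exists>\<^sub>F k in sequentially. card (chosen k \<inter> (whole True \<union> whole False)) \<le> 2"
    using critical_frequently
  proof (rule frequently_elim1)
    fix k assume k: "2 \<le> k \<and> \<not> one_sided k (part k)"
    have "card (chosen k) \<le> 2" using k assms chosen_critical[of k] by (simp add: card_insert_if)
    moreover have "card (chosen k \<inter> (whole True \<union> whole False)) \<le> card (chosen k)"
      by (intro card_mono finite_chosen) simp
    ultimately show "card (chosen k \<inter> (whole True \<union> whole False)) \<le> 2" by simp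
  qed
qed

lemma critical_union_splits:
  assumes "\<not> p"
  shows "splits_into_two_bases (whole True \<union> whole False)"
proof -
  have "asymptotic_basis (whole False)"
  proof (rule asymptotic_basis_whole)
    show "\<forall>\<^sub>F k in sequentially. chosen k \<inter> whole False \<noteq> {}"
      using eventually_ge_at_top[of 2]
    proof eventually_elim
      case (elim k)
      have "Max (part k False) \<in> chosen k \<inter> whole False"
        using chosen_critical[OF _ elim] assms Max_part(1)[OF elim, of False] part_subset_whole[of k False]
        by auto
      then show ?case by blast
    qed
  qed
  moreover have "asymptotic_basis (whole True)"
    using critical_minimal by (simp add: minimal_asymptotic_basis_def)
  moreover have "whole True \<inter> whole False = {}" using whole_disjoint by blast
  ultimately show ?thesis unfolding splits_into_two_bases_def by blast
qed

lemma critical_union_example: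
  "\<exists>A. asymptotic_basis A \<and> (rep_tends_to_infinity A \<longleftrightarrow> p) \<and>
    (splits_into_two_bases A \<longleftrightarrow> \<not> p) \<and> contains_minimal_basis A"
proof (intro exI conjI)
  show "rep_tends_to_infinity (whole True \<union> whole False) \<longleftrightarrow> p"
    using critical_rep critical_union_not_rep by blast
  show "splits_into_two_bases (whole True \<union> whole False) \<longleftrightarrow> \<not> p"
    using critical_union_splits critical_union_not_splits by blast
qed (rule critical_union_basis critical_union_contains_minimal)+

lemma minimal_example:
  "\<exists>A. minimal_asymptotic_basis A \<and> \<not> rep_tends_to_infinity A"
  using critical_minimal critical_whole_not_rep by blast

end

section \<open>The remaining two cases and the collection of all eight\<close>

lemma minimal_not_splits:
  assumes "minimal_asymptotic_basis A"
  shows "\<not> splits_into_two_bases A"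
proof
  assume "splits_into_two_bases A"
  then obtain B C where "A = B \<union> C" "B \<inter> C = {}" "asymptotic_basis B" "asymptotic_basis C"
    unfolding splits_into_two_bases_def by blast
  moreover from this have "B \<subset> A" using basis_nonempty[of C] by blast
  ultimately show False using assms unfolding minimal_asymptotic_basis_def by blast
qed

lemma hue_basis: "asymptotic_basis {x. hue x = c}"
  unfolding asymptotic_basis_iff
  using eventually_ge_at_top[of 8]
proof eventually_elim
  case (elim m)
  have "1 \<le> card {x \<in> {x. hue x = c}. x \<le> m \<and> m - x \<in> {x. hue x = c}}"
    by (rule card_solid_sums[where a = 0 and a' = 0 and b = "m + 9" and b' = "m + 9" and c = c])
      (use elim in auto)
  then show ?case by (intro represents_if_few_missing[of "{x. hue x = c}"]) simp
qed

text \<open>The two hues split the natural numbers into bases, and any minimal basis constructed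
  above is a subset.\<close>

lemma UNIV_example:
  "asymptotic_basis UNIV \<and> rep_tends_to_infinity UNIV \<and> splits_into_two_bases UNIV \<and>
    contains_minimal_basis UNIV"
proof (intro conjI)
  show "asymptotic_basis UNIV" by (rule asymptotic_basis_mono[OF hue_basis[of True]]) simp
  show "splits_into_two_bases UNIV"
    unfolding splits_into_two_bases_def
    by (rule exI[of _ "{x. hue x = True}"], rule exI[of _ "{x. hue x = False}"]) (use hue_basis[of True] hue_basis[of False] in auto)
  show "contains_minimal_basis UNIV"
    unfolding contains_minimal_basis_def using minimal_example by blast
  show "rep_tends_to_infinity UNIV"
    unfolding rep_tends_to_infinity_def filterlim_at_top
  proof
    fix R
    show "\<forall>\<^sub>F n in sequentially. R \<le> rep UNIV n"
      using eventually_ge_at_top[of "2 * R"]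
    proof eventually_elim
      case (elim n)
      have "{x \<in> UNIV. x \<le> n \<and> n - x \<in> UNIV} = {..n}" by auto
      then show ?case using card_summands_le_rep[of UNIV n] elim by simp
    qed
  qed
qed

theorem theorem1:
  shows "\<forall>p1 p2 p3 :: bool. \<exists>A :: nat set.
    asymptotic_basis A \<and>
    (rep_tends_to_infinity A \<longleftrightarrow> p1) \<and>
    (splits_into_two_bases A \<longleftrightarrow> p2) \<and>
    (contains_minimal_basis A \<longleftrightarrow> p3)"
proof (intro allI)
  fix p1 p2 p3 :: bool
  let ?goal = "\<exists>A :: nat set. asymptotic_basis A \<and> (rep_tends_to_infinity A \<longleftrightarrow> p1) \<and>
    (splits_into_two_bases A \<longleftrightarrow> p2) \<and> (contains_minimal_basis A \<longleftrightarrow> p3)"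
  \<comment> \<open>The balanced sets settle the four cases without (P3), with either value of (P1):
    the union splits, one class does not. With (P3), the critical union has exactly one of (P1) and
    (P2), the set of all natural numbers has both, and a minimal basis itself has neither.\<close>
  consider "\<not> p3" "p2" | "\<not> p3" "\<not> p2" | "p3" "p1 = (\<not> p2)" | "p1" "p2" "p3" | "\<not> p1" "\<not> p2" "p3" by blast
  then show ?goal
  proof cases
    case 1
    then show ?thesis using balanced_split_example[of p1] by auto
  next
    case 2
    then show ?thesis using balanced_nonsplit_example[of p1] by auto
  next
    case 3
    then show ?thesis using critical_union_example[of p1] by auto
  next
    case 4
    then show ?thesis using UNIV_example by auto
  next
    case 5
    obtain A where A: "minimal_asymptotic_basis A" "\<not> rep_tends_to_infinity A"
      using minimal_example by blast
    then have "asymptotic_basis A" "contains_minimal_basis A"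
      by (auto simp: minimal_asymptotic_basis_def contains_minimal_basis_def)
    then show ?thesis using 5 A minimal_not_splits by blast
  qed
qed

end
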